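(* Let $M=\mathrm{Span}\{e_{11}+e_{33},e_{12},e_{13},e_{22},e_{23}\}\subset M_3(\mathbb{C})$. The following four subalgebras of $M_3(\mathbb{C})$ lie in pairwise different orbits under the action of automorphisms and antiautomorphisms of $M_3(\mathbb{C})$ preserving $M$; that is, for any two distinct subalgebras $S,S'$ in the list there is no automorphism or antiautomorphism $\varphi$ of $M_3(\mathbb{C})$ with $\varphi(M)=M$ and $\varphi(S)=S'$: (Z1) $\mathrm{Span}\{e_{11},e_{21},e_{31},e_{32}\}$; (Z2) $\mathrm{Span}\{e_{11},e_{21},e_{31},e_{32}+e_{33}\}$; (Z3) $\mathrm{Span}\{e_{11}+e_{22},e_{21},e_{31},e_{32}\}$; (Z4) $\mathrm{Span}\{e_{11}+e_{22},e_{21}+e_{12},e_{31},e_{32}\}$.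
   Context: $M_3(\mathbb{C})$ is the algebra of $3\times3$ complex matrices, $e_{ij}$ are the matrix units, and $\mathrm{Span}$ means linear span over $\mathbb{C}$. An automorphism is a $\mathbb{C}$-algebra automorphism of $M_3(\mathbb{C})$; an antiautomorphism is the composition of an automorphism and the transpose map. *)

theory Defs
  imports "HOL-Analysis.Analysis"
begin

type_synonym mat3 = "complex ^ 3 ^ 3"

definition mscale :: "complex \<Rightarrow> mat3 \<Rightarrow> mat3" where
  "mscale c A = (\<chi> i j. c * A $ i $ j)"

text \<open>The library only provides \<^typ>\<open>complex ^ 3 ^ 3\<close> with a real vector space structure, so the
  complex one is set up here; \<open>M3.span\<close> and \<open>M3.subspace\<close> are over the complex numbers.\<close>

global_interpretation M3: vector_space mscale
  by standard (simp_all add: mscale_def vec_eq_iff algebra_simps)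

text \<open>In the index type \<open>3\<close> one has \<open>3 = 0\<close>, so \<open>1, 2, 3\<close> are its three distinct elements.\<close>

definition E :: "3 \<Rightarrow> 3 \<Rightarrow> mat3" where
  "E i j = (\<chi> k l. if k = i \<and> l = j then 1 else 0)"

definition subalgebra :: "mat3 set \<Rightarrow> bool" where
  "subalgebra S \<longleftrightarrow> M3.subspace S \<and> (\<forall>A\<in>S. \<forall>B\<in>S. A ** B \<in> S)"

text \<open>Preservation of the identity matrix follows from multiplicativity and surjectivity.\<close>

definition automorphism :: "(mat3 \<Rightarrow> mat3) \<Rightarrow> bool" where
  "automorphism f \<longleftrightarrow>
     Vector_Spaces.linear mscale mscale f \<and> (\<forall>A B. f (A ** B) = f A ** f B) \<and> bij f"

text \<open>The order of composition is immaterial: conjugating an automorphism with the transpose map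
  gives an automorphism.\<close>

definition antiautomorphism :: "(mat3 \<Rightarrow> mat3) \<Rightarrow> bool" where
  "antiautomorphism f \<longleftrightarrow> (\<exists>g. automorphism g \<and> f = g \<circ> transpose)"

definition M :: "mat3 set" where
  "M = M3.span {E 1 1 + E 3 3, E 1 2, E 1 3, E 2 2, E 2 3}"

definition Z1 :: "mat3 set" where
  "Z1 = M3.span {E 1 1, E 2 1, E 3 1, E 3 2}"

definition Z2 :: "mat3 set" where
  "Z2 = M3.span {E 1 1, E 2 1, E 3 1, E 3 2 + E 3 3}"

definition Z3 :: "mat3 set" where
  "Z3 = M3.span {E 1 1 + E 2 2, E 2 1, E 3 1, E 3 2}"

definition Z4 :: "mat3 set" where
  "Z4 = M3.span {E 1 1 + E 2 2, E 2 1 + E 1 2, E 3 1, E 3 2}"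

definition same_orbit :: "mat3 set \<Rightarrow> mat3 set \<Rightarrow> bool" where
  "same_orbit S S' \<longleftrightarrow>
     (\<exists>\<phi>. (automorphism \<phi> \<or> antiautomorphism \<phi>) \<and> \<phi> ` M = M \<and> \<phi> ` S = S')"

end

theory Submission
  imports Defs
begin

text \<open>The four algebras are told apart by their multiplication: no two of them are isomorphic or
  anti-isomorphic as algebras. Three properties separate them, each phrased by products and
  zero only, and symmetrically in left and right, so that it is invariant under automorphisms and
  antiautomorphisms alike (\<open>same_orbit_invariants\<close>).

  \<^item> \<open>Z2\<close>, \<open>Z3\<close> and \<open>Z4\<close> have a right identity, while \<open>Z1\<close> has no identity on either side.
  \<^item> The square-zero elements of \<open>Z2\<close> and of \<open>Z4\<close> form the radical, which has zero
    multiplication, while in \<open>Z3\<close> the square-zero elements \<open>e\<^sub>3\<^sub>2\<close> and \<open>e\<^sub>2\<^sub>1\<close> multiply to \<open>e\<^sub>3\<^sub>1\<close>.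
  \<^item> The radical of \<open>Z4\<close> is killed by multiplication from the left, while in \<open>Z2\<close> the idempotents
    \<open>e\<^sub>1\<^sub>1\<close> and \<open>e\<^sub>3\<^sub>2 + e\<^sub>3\<^sub>3\<close> act as the identity on \<open>e\<^sub>3\<^sub>1\<close>, from the right and from the left.\<close>

definition has_one_sided_identity :: "mat3 set \<Rightarrow> bool" where
  "has_one_sided_identity S \<longleftrightarrow>
     (\<exists>R\<in>S. \<forall>X\<in>S. X ** R = X) \<or> (\<exists>R\<in>S. \<forall>X\<in>S. R ** X = X)"

definition square_zero_products_vanish :: "mat3 set \<Rightarrow> bool" where
  "square_zero_products_vanish S \<longleftrightarrow>
     (\<forall>A\<in>S. \<forall>B\<in>S. A ** A = 0 \<longrightarrow> B ** B = 0 \<longrightarrow> A ** B = 0)"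

definition square_zero_annihilated_on_one_side :: "mat3 set \<Rightarrow> bool" where
  "square_zero_annihilated_on_one_side S \<longleftrightarrow>
     (\<forall>X\<in>S. \<forall>N\<in>S. N ** N = 0 \<longrightarrow> X ** N = 0) \<or> (\<forall>X\<in>S. \<forall>N\<in>S. N ** N = 0 \<longrightarrow> N ** X = 0)"

section \<open>Invariance under automorphisms and antiautomorphisms\<close>

lemma transpose_eq_iff: "transpose A = transpose B \<longleftrightarrow> A = B"
  by (metis transpose_transpose)

lemma automorphism_zero: "automorphism f \<Longrightarrow> f 0 = 0"
  unfolding automorphism_def Vector_Spaces.linear_def
  by (metis module_hom.zero module_hom_iff_linear Vector_Spaces.linear_def)

lemma same_orbitE:
  assumes "same_orbit S S'"
  obtains f where "inj f" "f 0 = 0" "S' = f ` S"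
    "(\<forall>A B. f (A ** B) = f A ** f B) \<or> (\<forall>A B. f (A ** B) = f B ** f A)"
proof -
  obtain f where f: "automorphism f \<or> antiautomorphism f" and S': "S' = f ` S"
    using assms unfolding same_orbit_def by blast
  from f have "inj f \<and> f 0 = 0 \<and>
    ((\<forall>A B. f (A ** B) = f A ** f B) \<or> (\<forall>A B. f (A ** B) = f B ** f A))"
  proof
    assume "automorphism f"
    then show ?thesis
      using automorphism_zero by (auto simp: automorphism_def bij_def)
  next
    assume "antiautomorphism f"
    then obtain g where g: "automorphism g" and f: "f = g \<circ> transpose"
      unfolding antiautomorphism_def by blast
    have "inj f"
      using g by (auto simp: f automorphism_def bij_def inj_def transpose_eq_iff)
    moreover have "transpose (0::mat3) = 0"
      by (simp add: transpose_def vec_eq_iff)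
    then have "f 0 = 0"
      using automorphism_zero[OF g] by (simp add: f)
    moreover have "\<forall>A B. f (A ** B) = f B ** f A"
      using g by (simp add: f automorphism_def matrix_transpose_mul)
    ultimately show ?thesis by blast
  qed
  with S' that show thesis by blast
qed

text \<open>A map that reverses products interchanges the two alternatives in the first and in the third
  property, and the roles of \<open>A\<close> and \<open>B\<close> in the second.\<close>

lemma same_orbit_invariants:
  assumes "same_orbit S S'"
  shows "has_one_sided_identity S' \<longleftrightarrow> has_one_sided_identity S"
    and "square_zero_products_vanish S' \<longleftrightarrow> square_zero_products_vanish S"
    and "square_zero_annihilated_on_one_side S' \<longleftrightarrow> square_zero_annihilated_on_one_side S"
proof -
  obtain f where f: "inj f" "f 0 = 0" and S': "S' = f ` S"
    and mult: "(\<forall>A B. f (A ** B) = f A ** f B) \<or> (\<forall>A B. f (A ** B) = f B ** f A)"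
    using assms by (rule same_orbitE)
  have eq: "f A = f B \<longleftrightarrow> A = B" and zero: "f A = 0 \<longleftrightarrow> A = 0" for A B
    using f by (metis injD)+
  from mult have "(has_one_sided_identity S' \<longleftrightarrow> has_one_sided_identity S) \<and>
    (square_zero_products_vanish S' \<longleftrightarrow> square_zero_products_vanish S) \<and>
    (square_zero_annihilated_on_one_side S' \<longleftrightarrow> square_zero_annihilated_on_one_side S)"
  proof
    assume "\<forall>A B. f (A ** B) = f A ** f B"
    then have m: "f A ** f B = f (A ** B)" for A B by simp
    show ?thesis
      unfolding has_one_sided_identity_def square_zero_products_vanish_def
        square_zero_annihilated_on_one_side_def S'
      by (simp add: m eq zero)
  next
    assume "\<forall>A B. f (A ** B) = f B ** f A"
    then have m: "f A ** f B = f (B ** A)" for A B by simp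
    show ?thesis
      unfolding has_one_sided_identity_def square_zero_products_vanish_def
        square_zero_annihilated_on_one_side_def S'
      by (simp add: m eq zero) blast
  qed
  then show "has_one_sided_identity S' \<longleftrightarrow> has_one_sided_identity S"
    and "square_zero_products_vanish S' \<longleftrightarrow> square_zero_products_vanish S"
    and "square_zero_annihilated_on_one_side S' \<longleftrightarrow> square_zero_annihilated_on_one_side S"
    by blast+
qed

section \<open>The four algebras in coordinates\<close>

lemmas mat3_simps = vec_eq_iff forall_3 E_def mscale_def matrix_matrix_mult_def sum_3

lemma Z1_iff: "A \<in> Z1 \<longleftrightarrow> A$1$2 = 0 \<and> A$1$3 = 0 \<and> A$2$2 = 0 \<and> A$2$3 = 0 \<and> A$3$3 = 0"
  by (auto simp: Z1_def M3.span_breakdown_eq mat3_simps)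

lemma Z2_iff: "A \<in> Z2 \<longleftrightarrow> A$1$2 = 0 \<and> A$1$3 = 0 \<and> A$2$2 = 0 \<and> A$2$3 = 0 \<and> A$3$2 = A$3$3"
  by (auto simp: Z2_def M3.span_breakdown_eq mat3_simps)

lemma Z3_iff: "A \<in> Z3 \<longleftrightarrow> A$1$2 = 0 \<and> A$1$3 = 0 \<and> A$2$3 = 0 \<and> A$3$3 = 0 \<and> A$1$1 = A$2$2"
  by (auto simp: Z3_def M3.span_breakdown_eq mat3_simps)

lemma Z4_iff: "A \<in> Z4 \<longleftrightarrow> A$1$3 = 0 \<and> A$2$3 = 0 \<and> A$3$3 = 0 \<and> A$1$1 = A$2$2 \<and> A$1$2 = A$2$1"
  by (auto simp: Z4_def M3.span_breakdown_eq mat3_simps)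

lemmas Z_iffs = Z1_iff Z2_iff Z3_iff Z4_iff

lemma subalgebra_Z: "subalgebra Z1" "subalgebra Z2" "subalgebra Z3" "subalgebra Z4"
proof -
  have "M3.subspace Z1" "M3.subspace Z2" "M3.subspace Z3" "M3.subspace Z4"
    by (simp_all add: Z1_def Z2_def Z3_def Z4_def M3.subspace_span)
  then show "subalgebra Z1" "subalgebra Z2" "subalgebra Z3" "subalgebra Z4"
    by (simp_all add: subalgebra_def Z_iffs mat3_simps algebra_simps)
qed

section \<open>The values of the invariants\<close>

text \<open>A right identity would have to fix \<open>e\<^sub>3\<^sub>2\<close>, so its second row would be that of the unit
  matrix; a left identity would likewise have the third column of the unit matrix. But in \<open>Z1\<close> the
  last two diagonal entries vanish.\<close>

lemma no_identity_Z1: "\<not> has_one_sided_identity Z1"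
proof -
  have "E 3 2 \<in> Z1"
    by (simp add: Z1_iff E_def)
  moreover have "E 3 2 ** R \<noteq> E 3 2" "R ** E 3 2 \<noteq> E 3 2" if "R \<in> Z1" for R
    using that by (simp_all add: Z1_iff mat3_simps)
  ultimately show ?thesis
    unfolding has_one_sided_identity_def by blast
qed

text \<open>The elements of \<open>Z2\<close> are matrices with equal second and third columns, so they all kill the
  difference of the second and third basis vectors. The right identity below is an idempotent
  whose kernel is spanned by this difference.\<close>

lemma identity_Z2: "has_one_sided_identity Z2"
proof -
  have "E 1 1 + (E 3 2 + E 3 3) \<in> Z2" "\<forall>X\<in>Z2. X ** (E 1 1 + (E 3 2 + E 3 3)) = X"
    by (simp_all add: Z2_iff mat3_simps)
  then show ?thesis
    unfolding has_one_sided_identity_def by blast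
qed

lemma identity_Z3_Z4: "has_one_sided_identity Z3" "has_one_sided_identity Z4"
proof -
  have "E 1 1 + E 2 2 \<in> Z3" "\<forall>X\<in>Z3. X ** (E 1 1 + E 2 2) = X"
    "E 1 1 + E 2 2 \<in> Z4" "\<forall>X\<in>Z4. X ** (E 1 1 + E 2 2) = X"
    by (simp_all add: Z3_iff Z4_iff mat3_simps)
  then show "has_one_sided_identity Z3" "has_one_sided_identity Z4"
    unfolding has_one_sided_identity_def by blast+
qed

lemma square_zero_Z2: "A \<in> Z2 \<Longrightarrow> A ** A = 0 \<longleftrightarrow> A$1$1 = 0 \<and> A$3$3 = 0"
  by (auto simp: Z2_iff mat3_simps)

text \<open>The upper left block \<open>a + b (e\<^sub>1\<^sub>2 + e\<^sub>2\<^sub>1)\<close> of an element of \<open>Z4\<close> has the eigenvalues \<open>a + b\<close>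
  and \<open>a - b\<close>, which vanish together only for \<open>a = b = 0\<close>.\<close>

lemma square_zero_Z4:
  assumes "A \<in> Z4"
  shows "A ** A = 0 \<longleftrightarrow> A$1$1 = 0 \<and> A$1$2 = 0"
proof
  assume "A ** A = 0"
  then have "(A$1$1)\<^sup>2 + (A$1$2)\<^sup>2 = 0" "A$1$1 * A$1$2 = 0"
    using assms by (auto simp: Z4_iff mat3_simps power2_eq_square)
  then show "A$1$1 = 0 \<and> A$1$2 = 0"
    by auto
qed (use assms in \<open>auto simp: Z4_iff mat3_simps\<close>)

lemma products_vanish_Z2: "square_zero_products_vanish Z2"
  unfolding square_zero_products_vanish_def
  by (auto simp: square_zero_Z2) (auto simp: Z2_iff mat3_simps)

lemma products_vanish_Z4: "square_zero_products_vanish Z4"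
  unfolding square_zero_products_vanish_def
  by (auto simp: square_zero_Z4) (auto simp: Z4_iff mat3_simps)

lemma not_products_vanish_Z3: "\<not> square_zero_products_vanish Z3"
proof -
  have "E 3 2 \<in> Z3" "E 2 1 \<in> Z3" "E 3 2 ** E 3 2 = 0" "E 2 1 ** E 2 1 = 0"
    "E 3 2 ** E 2 1 \<noteq> 0"
    by (simp_all add: Z3_iff mat3_simps)
  then show ?thesis
    unfolding square_zero_products_vanish_def by blast
qed

lemma annihilated_Z4: "square_zero_annihilated_on_one_side Z4"
proof -
  have "X ** N = 0" if "X \<in> Z4" "N \<in> Z4" "N ** N = 0" for X N
    using that(1,2) that(3)[unfolded square_zero_Z4[OF that(2)]]
    by (auto simp: Z4_iff mat3_simps)
  then show ?thesis
    unfolding square_zero_annihilated_on_one_side_def by blast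
qed

lemma not_annihilated_Z2: "\<not> square_zero_annihilated_on_one_side Z2"
proof -
  have "E 3 1 \<in> Z2" "E 3 1 ** E 3 1 = 0"
    "E 1 1 \<in> Z2" "E 3 1 ** E 1 1 \<noteq> 0"
    "E 3 2 + E 3 3 \<in> Z2" "(E 3 2 + E 3 3) ** E 3 1 \<noteq> 0"
    by (simp_all add: Z2_iff mat3_simps)
  then show ?thesis
    unfolding square_zero_annihilated_on_one_side_def by blast
qed

section \<open>Separation of the orbits\<close>

theorem mainTheorem12:
  shows "(\<forall>S \<in> set [Z1, Z2, Z3, Z4]. subalgebra S) \<and>
    (\<forall>i < 4. \<forall>j < 4. i \<noteq> j \<longrightarrow>
       \<not> same_orbit ([Z1, Z2, Z3, Z4] ! i) ([Z1, Z2, Z3, Z4] ! j))"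
proof (intro conjI allI impI)
  show "\<forall>S \<in> set [Z1, Z2, Z3, Z4]. subalgebra S"
    by (simp add: subalgebra_Z)
next
  fix i j :: nat
  assume ij: "i < 4" "j < 4" "i \<noteq> j"
  let ?Z = "[Z1, Z2, Z3, Z4]"
  show "\<not> same_orbit (?Z ! i) (?Z ! j)"
  proof
    assume "same_orbit (?Z ! i) (?Z ! j)"
    note inv = same_orbit_invariants[OF this]
    have "i \<in> {0, 1, 2, 3}" "j \<in> {0, 1, 2, 3}"
      using ij by auto
    with inv \<open>i \<noteq> j\<close> show False
      by (auto simp: no_identity_Z1 identity_Z2 identity_Z3_Z4 products_vanish_Z2
          products_vanish_Z4 not_products_vanish_Z3 annihilated_Z4 not_annihilated_Z2)
  qed
qed

end
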